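(* Let $H$ be a digraph (possibly with loops), $D$ an $H$-colored digraph, $\mathscr{F}$ a walk-preservative $H$-class partition of $A(D)$, and $k,l\in\mathbb{N}$ with $k\geq 2$, $l\geq 1$. If $\mathcal{S}$ is a $(k,l)$-kernel in $C_{\mathscr{F}}(D)$ such that $N^{+}(\mathcal{S})=\emptyset$, then $D$ has a $(k,l+1,H)$-kernel by walks.
   Context: An $H$-colored digraph is a finite digraph $D$ without loops with a coloring $\rho:A(D)\to V(H)$. For $F\subseteq A(D)$, $D\langle F\rangle$ is the digraph with arc set $F$ and vertex set the vertices incident with an arc of $F$. An $H$-class partition of $A(D)$ is a partition $\mathscr{F}$ of $A(D)$ such that for all arcs $(u,v),(v,w)$ of $D$, $(\rho(u,v),\rho(v,w))\in A(H)$ iff some $F\in\mathscr{F}$ contains both arcs. The $H$-class digraph $C_{\mathscr{F}}(D)$ has vertex set $\mathscr{F}$, and $(F,G)$ (possibly a loop) is an arc iff there exist $(u,v)\in F$ and $(v,w)\in G$. $\mathscr{F}$ is walk-preservative if for every arc $(F,G)$ of $C_{\mathscr{F}}(D)$ and every $z\in V(D\langle F\rangle)$ there is a $zw$-path in $D\langle F\rangle$ for some $w\in V(D\langle G\rangle)$. For a set $\mathcal{S}$ of vertices of a digraph, $N^+(\mathcal{S})$ denotes the proper out-neighborhood: vertices not in $\mathcal{S}$ that receive an arc from a vertex of $\mathcal{S}$. For a digraph $G$ and $k\ge2$, $l\ge1$, a $(k,l)$-kernel is a set $S\subseteq V(G)$ such that every walk between two different vertices of $S$ has length at least $k$, and every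 vertex not in $S$ has a walk of length at most $l$ to $S$. For a walk $W=(x_0,\ldots,x_n)$ in $D$, there is an obstruction on $x_i$ if $(\rho(x_{i-1},x_i),\rho(x_i,x_{i+1}))\notin A(H)$; for open $W$, $O_H(W)$ is the set of $i\in\{1,\dots,n-1\}$ with an obstruction on $x_i$ and the $H$-length is $l_H(W)=|O_H(W)|+1$. A set $S\subseteq V(D)$ is a $(k,l,H)$-kernel by walks if every walk between two different vertices of $S$ has $H$-length at least $k$ and every $x\notin S$ has a walk to a vertex of $S$ of $H$-length at most $l$. *)

theory Defs
  imports "Graph_Theory.Graph_Theory" "HOL-Library.Disjoint_Sets"
begin

(* Digraphs have no parallel arcs, so an arc is a pair of vertices. The digraph of colours H may
   have loops and is not required to be finite; D is finite and loopless (pair_digraph). *)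
definition H_colored_digraph ::
    "'c pair_pre_digraph \<Rightarrow> 'v pair_pre_digraph \<Rightarrow> ('v \<times> 'v \<Rightarrow> 'c) \<Rightarrow> bool" where
  "H_colored_digraph H D \<rho> \<longleftrightarrow>
     pair_wf_digraph H \<and> pair_digraph D \<and> (\<forall>a\<in>parcs D. \<rho> a \<in> pverts H)"

(* D<F>; the ambient digraph D does not enter apart from F being a set of its arcs. *)
definition arc_induced :: "('v \<times> 'v) set \<Rightarrow> 'v pair_pre_digraph" where
  "arc_induced F = \<lparr> pverts = fst ` F \<union> snd ` F, parcs = F \<rparr>"

definition H_class_partition ::
    "'c pair_pre_digraph \<Rightarrow> 'v pair_pre_digraph \<Rightarrow> ('v \<times> 'v \<Rightarrow> 'c) \<Rightarrow> ('v \<times> 'v) set set \<Rightarrow> bool" where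
  "H_class_partition H D \<rho> \<F> \<longleftrightarrow>
     partition_on (parcs D) \<F> \<and>
     (\<forall>u v w. (u, v) \<in> parcs D \<longrightarrow> (v, w) \<in> parcs D \<longrightarrow>
        ((\<rho> (u, v), \<rho> (v, w)) \<in> parcs H \<longleftrightarrow> (\<exists>F\<in>\<F>. (u, v) \<in> F \<and> (v, w) \<in> F)))"

definition H_class_digraph :: "('v \<times> 'v) set set \<Rightarrow> ('v \<times> 'v) set pair_pre_digraph" where
  "H_class_digraph \<F> =
     \<lparr> pverts = \<F>,
       parcs = {(F, G). F \<in> \<F> \<and> G \<in> \<F> \<and> (\<exists>u v w. (u, v) \<in> F \<and> (v, w) \<in> G)} \<rparr>"

(* The path may be trivial (a single vertex), namely when z itself lies in D<G>. *)
definition walk_preservative :: "('v \<times> 'v) set set \<Rightarrow> bool" where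
  "walk_preservative \<F> \<longleftrightarrow>
     (\<forall>(F, G)\<in>parcs (H_class_digraph \<F>). \<forall>z\<in>pverts (arc_induced F).
        \<exists>w\<in>pverts (arc_induced G). \<exists>p. vpath p (with_proj (arc_induced F)) \<and> hd p = z \<and> last p = w)"

definition out_neighborhood :: "'a pair_pre_digraph \<Rightarrow> 'a set \<Rightarrow> 'a set" where
  "out_neighborhood G S = {v \<in> pverts G. v \<notin> S \<and> (\<exists>u\<in>S. (u, v) \<in> parcs G)}"

definition kl_kernel :: "'a pair_pre_digraph \<Rightarrow> nat \<Rightarrow> nat \<Rightarrow> 'a set \<Rightarrow> bool" where
  "kl_kernel G k l S \<longleftrightarrow>
     S \<subseteq> pverts G \<and>
     (\<forall>p. vwalk p (with_proj G) \<and> hd p \<in> S \<and> last p \<in> S \<and> hd p \<noteq> last p \<longrightarrow> k \<le> vwalk_length p) \<and>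
     (\<forall>x\<in>pverts G - S. \<exists>p. vwalk p (with_proj G) \<and> hd p = x \<and> last p \<in> S \<and> vwalk_length p \<le> l)"

(* A walk (x_0, ..., x_n) is the list [x_0, ..., x_n], so the internal positions 1, ..., n - 1
   are those in {1..<length p - 1}. *)
definition obstructions ::
    "'c pair_pre_digraph \<Rightarrow> ('v \<times> 'v \<Rightarrow> 'c) \<Rightarrow> 'v list \<Rightarrow> nat set" where
  "obstructions H \<rho> p =
     {i \<in> {1..<length p - 1}. (\<rho> (p ! (i - 1), p ! i), \<rho> (p ! i, p ! (i + 1))) \<notin> parcs H}"

(* Only meant for open walks, i.e. those with different end vertices; closed walks would in
   addition need the obstruction at the common end vertex to be taken into account. *)
definition H_length ::
    "'c pair_pre_digraph \<Rightarrow> ('v \<times> 'v \<Rightarrow> 'c) \<Rightarrow> 'v list \<Rightarrow> nat" where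
  "H_length H \<rho> p = card (obstructions H \<rho> p) + 1"

definition klH_kernel_by_walks ::
    "'c pair_pre_digraph \<Rightarrow> 'v pair_pre_digraph \<Rightarrow> ('v \<times> 'v \<Rightarrow> 'c) \<Rightarrow> nat \<Rightarrow> nat \<Rightarrow> 'v set \<Rightarrow> bool" where
  "klH_kernel_by_walks H D \<rho> k l S \<longleftrightarrow>
     S \<subseteq> pverts D \<and>
     (\<forall>p. vwalk p (with_proj D) \<and> hd p \<in> S \<and> last p \<in> S \<and> hd p \<noteq> last p \<longrightarrow> k \<le> H_length H \<rho> p) \<and>
     (\<forall>x\<in>pverts D - S. \<exists>p. vwalk p (with_proj D) \<and> hd p = x \<and> last p \<in> S \<and> H_length H \<rho> p \<le> l)"

end

theory Submission
  imports Defs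
begin

text \<open>
  A class in \<open>S\<close> has no out-neighbour other than itself, so a walk of \<open>D\<close> that has used an arc of
  \<open>F \<in> S\<close> never leaves \<open>F\<close>, and every terminal strong component of \<open>D\<langle>F\<rangle>\<close> is one of \<open>D\<close>.
  The kernel consists of one representative of each terminal strong component of \<open>D\<close>; no walk joins
  two of them. From a vertex with an out-arc in \<open>F\<close>, a walk from \<open>F\<close> to \<open>S\<close> in the class digraph
  lifts to a walk of \<open>D\<close> that stays in one class except for at most \<open>l\<close> changes, and ends
  at a representative.
\<close>

section \<open>Terminal strong components and their representatives\<close>

definition terminal :: "('a \<times> 'a) set \<Rightarrow> 'a \<Rightarrow> bool" where
  "terminal r x \<longleftrightarrow> (\<forall>y. (x, y) \<in> r\<^sup>* \<longrightarrow> (y, x) \<in> r\<^sup>*)"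

text \<open>The choice depends on \<open>x\<close> only through its set of reachable vertices. For a
  terminal vertex this set is its strong component, so all vertices of that component receive the
  same representative.\<close>

definition representative :: "('a \<times> 'a) set \<Rightarrow> 'a \<Rightarrow> 'a" where
  "representative r x = (SOME y. (x, y) \<in> r\<^sup>*)"

lemma reachable_representative: "(x, representative r x) \<in> r\<^sup>*"
  unfolding representative_def by (rule someI[of _ x]) simp

lemma terminal_reachable:
  assumes "terminal r x" "(x, y) \<in> r\<^sup>*"
  shows "terminal r y" "representative r y = representative r x"
proof -
  have yx: "(y, x) \<in> r\<^sup>*"
    using assms by (auto simp: terminal_def)
  show "terminal r y"
    using assms yx unfolding terminal_def by (meson rtrancl_trans)
  have "(\<lambda>z. (x, z) \<in> r\<^sup>*) = (\<lambda>z. (y, z) \<in> r\<^sup>*)"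
    using assms yx by (auto intro: rtrancl_trans)
  then show "representative r y = representative r x"
    by (simp add: representative_def)
qed

text \<open>Among the vertices reachable from \<open>x\<close>, take \<open>t\<close> with the
  fewest reachable vertices. Any \<open>y\<close> reachable from \<open>t\<close> reaches a subset
  of what \<open>t\<close> reaches, hence by minimality the same set, which contains
  \<open>t\<close>.\<close>

lemma finite_reaches_terminal:
  assumes "finite r"
  obtains t where "(x, t) \<in> r\<^sup>*" "terminal r t"
proof -
  have fin: "finite (r\<^sup>* `` {y})" for y
  proof (rule finite_subset)
    show "r\<^sup>* `` {y} \<subseteq> insert y (snd ` r)"
      by (auto elim: rtranclE simp: image_iff) (metis rtranclE snd_conv)
    show "finite (insert y (snd ` r))"
      using assms by simp
  qed
  obtain t where t: "(x, t) \<in> r\<^sup>*"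
      and least: "\<And>y. (x, y) \<in> r\<^sup>* \<Longrightarrow> card (r\<^sup>* `` {t}) \<le> card (r\<^sup>* `` {y})"
    using arg_min_nat_lemma[of "\<lambda>y. (x, y) \<in> r\<^sup>*" x "\<lambda>y. card (r\<^sup>* `` {y})"] by blast
  have "(y, t) \<in> r\<^sup>*" if ty: "(t, y) \<in> r\<^sup>*" for y
  proof -
    have "r\<^sup>* `` {y} \<subseteq> r\<^sup>* `` {t}"
      using ty by (auto intro: rtrancl_trans)
    then have "r\<^sup>* `` {y} = r\<^sup>* `` {t}"
      using least[of y] t ty fin by (meson card_seteq rtrancl_trans)
    then show ?thesis by blast
  qed
  with t show ?thesis
    using that by (auto simp: terminal_def)
qed

section \<open>Walks, obstructions and the cost of entering a class\<close>

lemma vwalk_Cons_Cons: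
  "vwalk (x # y # p) G \<longleftrightarrow> x \<in> verts G \<and> (x, y) \<in> arcs_ends G \<and> vwalk (y # p) G"
  by (auto simp: vwalk_def)

lemma vwalk_reachable:
  assumes "vwalk p (with_proj G)"
  shows "(hd p, last p) \<in> (parcs G)\<^sup>*"
  using assms
proof (induction p rule: vwalk_arcs.induct)
  case (3 u v es)
  then have "(u, v) \<in> parcs G" "(hd (v # es), last (v # es)) \<in> (parcs G)\<^sup>*"
    by (simp_all add: vwalk_Cons_Cons)
  then show ?case
    by (simp add: converse_rtrancl_into_rtrancl)
qed (auto simp: vwalk_def)

lemma vpath_reachable:
  assumes "vpath p (with_proj (arc_induced F))"
  shows "(hd p, last p) \<in> F\<^sup>*"
  using vwalk_reachable[of p "arc_induced F"] assms
  by (auto simp: vpath_def arc_induced_def)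

lemma finite_obstructions [simp]: "finite (obstructions H \<rho> p)"
  by (simp add: obstructions_def)

lemma obstructions_short: "length p \<le> 2 \<Longrightarrow> obstructions H \<rho> p = {}"
  by (auto simp: obstructions_def)

lemma card_obstructions_Cons:
  "card (obstructions H \<rho> (x # y # z # p)) \<le> card (obstructions H \<rho> (y # z # p))
    + (if (\<rho> (x, y), \<rho> (y, z)) \<in> parcs H then 0 else 1)" (is "card ?A \<le> card ?B + _")
proof -
  \<comment> \<open>Prepending \<open>x\<close> shifts every old obstruction by one position. The
    only new internal position is 1, where the arcs \<open>(x, y)\<close> and \<open>(y, z)\<close>
    meet.\<close>
  let ?C = "if (\<rho> (x, y), \<rho> (y, z)) \<in> parcs H then {} else {1::nat}"
  have "?A \<subseteq> Suc ` ?B \<union> ?C"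
  proof
    fix i assume i: "i \<in> ?A"
    then obtain j where j: "i = Suc j"
      by (cases i) (auto simp: obstructions_def)
    show "i \<in> Suc ` ?B \<union> ?C"
    proof (cases j)
      case 0
      then show ?thesis using i j by (auto simp: obstructions_def)
    next
      case (Suc m)
      then have "j \<in> ?B" using i j by (auto simp: obstructions_def)
      then show ?thesis using j by auto
    qed
  qed
  then have "card ?A \<le> card (Suc ` ?B \<union> ?C)"
    by (intro card_mono) auto
  also have "\<dots> \<le> card (Suc ` ?B) + card ?C"
    by (rule card_Un_le)
  also have "\<dots> = card ?B + (if (\<rho> (x, y), \<rho> (y, z)) \<in> parcs H then 0 else 1)"
    by (simp add: card_image)
  finally show ?thesis .
qed

text \<open>The number of changes of class along a walk that is about to be entered through an arc of
  \<open>F\<close>; unlike the number of obstructions it never grows when an arc of \<open>F\<close> is prepended.\<close>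

definition entry_cost ::
    "'c pair_pre_digraph \<Rightarrow> ('v \<times> 'v \<Rightarrow> 'c) \<Rightarrow> ('v \<times> 'v) set \<Rightarrow> 'v list \<Rightarrow> nat" where
  "entry_cost H \<rho> F p = card (obstructions H \<rho> p)
     + (if 2 \<le> length p \<and> (p ! 0, p ! 1) \<notin> F then 1 else 0)"

lemma entry_cost_change: "entry_cost H \<rho> F p \<le> entry_cost H \<rho> G p + 1"
  by (auto simp: entry_cost_def)

text \<open>The new first arc lies in \<open>F\<close>, so the second summand vanishes on the left.
  If \<open>p\<close> continues in \<open>F\<close>, no obstruction arises at \<open>hd p\<close>;
  if it leaves \<open>F\<close>, the possible new obstruction is paid for by the 1 already charged
  to \<open>p\<close>.\<close>

lemma entry_cost_Cons:
  assumes "H_class_partition H D \<rho> \<F>" "F \<in> \<F>" "(x, hd p) \<in> F" "vwalk p (with_proj D)"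
  shows "entry_cost H \<rho> F (x # p) \<le> entry_cost H \<rho> F p"
proof -
  obtain y q where p: "p = y # q"
    using assms(4) by (cases p) (auto simp: vwalk_def)
  show ?thesis
  proof (cases q)
    case Nil
    then show ?thesis
      using assms(3) p by (simp add: entry_cost_def obstructions_short)
  next
    case (Cons z q')
    have "(x, y) \<in> parcs D"
      using assms(1-3) p by (auto simp: H_class_partition_def partition_on_def)
    moreover have "(y, z) \<in> parcs D"
      using assms(4) p Cons by (auto simp: vwalk_def)
    ultimately have "(y, z) \<in> F \<Longrightarrow> (\<rho> (x, y), \<rho> (y, z)) \<in> parcs H"
      using assms(1-3) p by (auto simp: H_class_partition_def)
    then show ?thesis
      using card_obstructions_Cons[of H \<rho> x y z q'] assms(3) p Cons
      by (auto simp: entry_cost_def split: if_splits)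
  qed
qed

lemma entry_cost_prepend:
  assumes "H_class_partition H D \<rho> \<F>" "pair_wf_digraph D" "F \<in> \<F>"
    and "(x, y) \<in> F\<^sup>*" "vwalk p (with_proj D)" "hd p = y"
  obtains q where "vwalk q (with_proj D)" "hd q = x" "last q = last p"
    "entry_cost H \<rho> F q \<le> entry_cost H \<rho> F p"
proof -
  have "\<exists>q. vwalk q (with_proj D) \<and> hd q = x \<and> last q = last p
          \<and> entry_cost H \<rho> F q \<le> entry_cost H \<rho> F p"
    using assms(4)
  proof (induction rule: converse_rtrancl_induct)
    case base
    then show ?case using assms(5,6) by blast
  next
    case (step x z)
    then obtain q where q: "vwalk q (with_proj D)" "hd q = z" "last q = last p"
        "entry_cost H \<rho> F q \<le> entry_cost H \<rho> F p"
      by blast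
    have xz: "(x, z) \<in> parcs D"
      using assms(1,3) step(1) by (auto simp: H_class_partition_def partition_on_def)
    then have "x \<in> pverts D"
      using assms(2) pair_wf_digraph.in_arcsD1 by fastforce
    then have "vwalk (x # q) (with_proj D)"
      using q(1,2) xz by (intro vwalk_consI) simp_all
    moreover have "entry_cost H \<rho> F (x # q) \<le> entry_cost H \<rho> F p"
      using entry_cost_Cons[OF assms(1,3), of x q] q step(1) by simp
    moreover have "last (x # q) = last p"
      using q by (auto simp: vwalk_def)
    ultimately show ?case
      by (metis list.sel(1))
  qed
  then show ?thesis using that by blast
qed

section \<open>Absorbing classes and the lifting of class walks\<close>

lemma terminal_absorbing_class:
  assumes sink: "\<And>u v w. (u, v) \<in> F \<Longrightarrow> (v, w) \<in> A \<Longrightarrow> (v, w) \<in> F"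
    and "F \<subseteq> A" "t \<in> fst ` F \<union> snd ` F" "terminal F t"
  shows "terminal A t" "A\<^sup>* `` {t} = F\<^sup>* `` {t}"
proof -
  \<comment> \<open>\<open>sink\<close> applies only after an arc of \<open>F\<close> has been used,
    so \<open>t\<close> needs an incoming one. If \<open>t\<close> has an out-arc in
    \<open>F\<close>, terminality gives a way back whose last arc enters \<open>t\<close> (a loop
    serves itself); otherwise \<open>t\<close> is incident with \<open>F\<close> only as a
    head.\<close>
  have entered: "\<exists>u. (u, t) \<in> F"
  proof (cases "\<exists>w. (t, w) \<in> F")
    case True
    then obtain w where "(t, w) \<in> F" by blast
    then show ?thesis
      using assms(4) by (metis r_into_rtrancl rtranclE terminal_def)
  qed (use assms(3) in force)
  have "(t, y) \<in> F\<^sup>*" if "(t, y) \<in> A\<^sup>*" for y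
    using that
  proof (induction rule: rtrancl_induct)
    case (step y z)
    have "\<exists>u. (u, y) \<in> F"
      using step(3) entered by (metis rtranclE)
    then have "(y, z) \<in> F"
      using sink step(2) by blast
    with step(3) show ?case by (rule rtrancl_into_rtrancl)
  qed simp
  moreover have "F\<^sup>* \<subseteq> A\<^sup>*"
    using assms(2) by (rule rtrancl_mono)
  ultimately show "A\<^sup>* `` {t} = F\<^sup>* `` {t}" "terminal A t"
    using assms(4) unfolding terminal_def by blast+
qed

text \<open>The class \<open>G\<close> of the next arc is again in \<open>S\<close>, because
  \<open>S\<close> has no proper out-neighbour. Were \<open>G\<close> different from
  \<open>F\<close>, then \<open>[F, G]\<close> would be a walk of length 1 < \<open>k\<close>
  between two members of the kernel.\<close>

lemma kernel_class_absorbing: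
  assumes "H_class_partition H D \<rho> \<F>" "k \<ge> 2" "kl_kernel (H_class_digraph \<F>) k l S"
    and "out_neighborhood (H_class_digraph \<F>) S = {}"
    and "F \<in> S" "(u, v) \<in> F" "(v, w) \<in> parcs D"
  shows "(v, w) \<in> F"
proof -
  have "(v, w) \<in> \<Union>\<F>"
    using assms(1,7) by (simp add: H_class_partition_def partition_on_def)
  then obtain G where G: "G \<in> \<F>" "(v, w) \<in> G" by blast
  have F: "F \<in> \<F>"
    using assms(3,5) by (auto simp: kl_kernel_def H_class_digraph_def)
  have arc: "(F, G) \<in> parcs (H_class_digraph \<F>)"
    using F G assms(6) by (auto simp: H_class_digraph_def)
  then have "G \<in> S"
    using assms(4,5) G by (auto simp: out_neighborhood_def H_class_digraph_def)
  moreover have "vwalk [F, G] (with_proj (H_class_digraph \<F>))"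
    using F G arc by (auto simp: vwalk_def H_class_digraph_def)
  moreover have "vwalk p (with_proj (H_class_digraph \<F>)) \<Longrightarrow> hd p \<in> S \<Longrightarrow> last p \<in> S
      \<Longrightarrow> hd p \<noteq> last p \<Longrightarrow> k \<le> vwalk_length p" for p
    using assms(3) unfolding kl_kernel_def by blast
  from this[of "[F, G]"] have "vwalk [F, G] (with_proj (H_class_digraph \<F>)) \<Longrightarrow> G \<in> S
      \<Longrightarrow> F \<noteq> G \<Longrightarrow> k \<le> vwalk_length [F, G]"
    using assms(5) by simp
  ultimately have "F \<noteq> G \<Longrightarrow> k \<le> vwalk_length [F, G]"
    by blast
  then show ?thesis
    using G assms(2) by (cases "F = G") auto
qed

text \<open>Walk-preservation leads from any vertex of \<open>F\<close> to a vertex of the next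
  class by arcs of \<open>F\<close> alone. Prepending these arcs does not raise the cost measured
  with \<open>F\<close>, and passing from \<open>G\<close> to \<open>F\<close> as entering class
  raises it by at most 1, the length of one class step.\<close>

lemma class_walk_lift:
  assumes part: "H_class_partition H D \<rho> \<F>" and wf: "pair_wf_digraph D"
    and pres: "walk_preservative \<F>"
    and absorb: "\<And>F x. F \<in> S \<Longrightarrow> x \<in> pverts (arc_induced F) \<Longrightarrow>
      \<exists>y\<in>K \<inter> pverts D. (x, y) \<in> F\<^sup>*"
    and "vwalk P (with_proj (H_class_digraph \<F>))" "last P \<in> S"
    and "x \<in> pverts (arc_induced (hd P))"
  shows "\<exists>p. vwalk p (with_proj D) \<and> hd p = x \<and> last p \<in> K
    \<and> entry_cost H \<rho> (hd P) p \<le> vwalk_length P"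
  using assms(5-)
proof (induction P arbitrary: x rule: vwalk_arcs.induct)
  case 1
  then show ?case by (simp add: vwalk_def)
next
  case (2 F)
  have F: "F \<in> \<F>"
    using 2 by (auto simp: vwalk_def H_class_digraph_def)
  have "F \<in> S" "x \<in> pverts (arc_induced F)"
    using 2 by simp_all
  from absorb[OF this] obtain y where y: "y \<in> K" "y \<in> pverts D" "(x, y) \<in> F\<^sup>*"
    by blast
  \<comment> \<open>The trivial walk has entry cost 0, which matches the length of the class walk
    \<open>[F]\<close>.\<close>
  have "vwalk [y] (with_proj D)" "hd [y] = y"
    using y by (simp_all add: vwalk_def)
  from entry_cost_prepend[OF part wf F y(3) this]
  obtain q where "vwalk q (with_proj D)" "hd q = x" "last q = y"
      "entry_cost H \<rho> F q \<le> entry_cost H \<rho> F [y]"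
    by auto
  then show ?case
    using y by (intro exI[of _ q]) (simp add: entry_cost_def[of _ _ _ "[y]"] obstructions_short)
next
  case (3 F G P)
  have arc: "(F, G) \<in> parcs (H_class_digraph \<F>)" and F: "F \<in> \<F>"
      and walk: "vwalk (G # P) (with_proj (H_class_digraph \<F>))"
    using "3.prems"(1) by (auto simp: vwalk_Cons_Cons H_class_digraph_def)
  obtain w p where w: "w \<in> pverts (arc_induced G)" "vpath p (with_proj (arc_induced F))"
      "hd p = x" "last p = w"
    using pres arc "3.prems"(3) unfolding walk_preservative_def by fastforce
  then have reach: "(x, w) \<in> F\<^sup>*"
    using vpath_reachable by blast
  obtain q where q: "vwalk q (with_proj D)" "hd q = w" "last q \<in> K"
      "entry_cost H \<rho> G q \<le> vwalk_length (G # P)"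
    using "3.IH"[OF walk, of w] "3.prems"(2) w(1) by auto
  obtain r where "vwalk r (with_proj D)" "hd r = x" "last r = last q"
      "entry_cost H \<rho> F r \<le> entry_cost H \<rho> F q"
    using entry_cost_prepend[OF part wf F reach q(1,2)] by blast
  then show ?case
    using q entry_cost_change[of H \<rho> F q G] by (intro exI[of _ r]) auto
qed

theorem theorem5:
  fixes H :: "'c pair_pre_digraph" and D :: "'v pair_pre_digraph"
    and \<rho> :: "'v \<times> 'v \<Rightarrow> 'c" and \<F> :: "('v \<times> 'v) set set"
    and S :: "('v \<times> 'v) set set" and k l :: nat
  assumes "H_colored_digraph H D \<rho>"
    and "H_class_partition H D \<rho> \<F>"
    and "walk_preservative \<F>"
    and "k \<ge> 2" and "l \<ge> 1"
    and "kl_kernel (H_class_digraph \<F>) k l S"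
    and "out_neighborhood (H_class_digraph \<F>) S = {}"
  shows "\<exists>K. klH_kernel_by_walks H D \<rho> k (l + 1) K"
proof -
  let ?A = "parcs D"
  define K where "K = {x \<in> pverts D. terminal ?A x \<and> representative ?A x = x}"
  have D: "pair_digraph D"
    using assms(1) by (simp add: H_colored_digraph_def)
  then have wf: "pair_wf_digraph D" and fin: "finite ?A"
    by (auto simp: pair_digraph_def pair_fin_digraph_def pair_fin_digraph_axioms_def)
  have verts: "x \<in> pverts D \<and> y \<in> pverts D" if "(x, y) \<in> ?A" for x y
    using wf that pair_wf_digraph.in_arcsD1 pair_wf_digraph.in_arcsD2 by metis
  have S_sub: "S \<subseteq> \<F>"
    using assms(6) by (auto simp: kl_kernel_def H_class_digraph_def)
  have absorb: "\<exists>y\<in>K \<inter> pverts D. (x, y) \<in> F\<^sup>*"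
    if F: "F \<in> S" and x: "x \<in> pverts (arc_induced F)" for F x
  proof -
    have FA: "F \<subseteq> ?A"
      using F S_sub assms(2) by (auto simp: H_class_partition_def partition_on_def)
    obtain t where t: "(x, t) \<in> F\<^sup>*" "terminal F t"
      using finite_reaches_terminal[of F x] FA fin finite_subset by blast
    have tF: "t \<in> fst ` F \<union> snd ` F"
      using t(1) x by (cases rule: rtranclE) (force simp: arc_induced_def)+
    have sink: "(v, w) \<in> F" if "(u, v) \<in> F" "(v, w) \<in> ?A" for u v w
      using kernel_class_absorbing[OF assms(2,4,6,7) F that] .
    have tA: "terminal ?A t" "?A\<^sup>* `` {t} = F\<^sup>* `` {t}"
      by (rule terminal_absorbing_class[OF _ FA tF t(2)], erule (1) sink)+
    let ?y = "representative ?A t"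
    have reach: "(t, ?y) \<in> ?A\<^sup>*"
      by (rule reachable_representative)
    have "t \<in> pverts D"
      using tF FA verts by force
    with reach have "?y \<in> pverts D"
      by (cases rule: rtranclE) (auto dest: verts)
    then have "?y \<in> K \<inter> pverts D"
      using terminal_reachable[OF tA(1) reach] by (simp add: K_def)
    \<comment> \<open>The representative was chosen among vertices reachable by arcs of
      \<open>D\<close>; equality of the two reachable sets puts the connection back inside
      \<open>F\<close>.\<close>
    have "(t, ?y) \<in> F\<^sup>*"
      using reach by (metis Image_singleton_iff tA(2))
    with t(1) have "(x, ?y) \<in> F\<^sup>*"
      by (rule rtrancl_trans)
    with \<open>?y \<in> K \<inter> pverts D\<close> show ?thesis
      by (rule bexI[rotated])
  qed
  have "klH_kernel_by_walks H D \<rho> k (l + 1) K"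
    unfolding klH_kernel_by_walks_def
  proof (intro conjI allI impI ballI)
    show "K \<subseteq> pverts D" by (auto simp: K_def)
  next
    fix p assume p: "vwalk p (with_proj D) \<and> hd p \<in> K \<and> last p \<in> K \<and> hd p \<noteq> last p"
    then have "(hd p, last p) \<in> ?A\<^sup>*"
      using vwalk_reachable by blast
    then have "hd p = last p"
      \<comment> \<open>Both ends are their own representatives and lie in one terminal component,
        so they coincide, contrary to the assumption on \<open>p\<close>.\<close>
      using p terminal_reachable(2)[of ?A "hd p" "last p"] by (simp add: K_def)
    with p show "k \<le> H_length H \<rho> p" by blast
  next
    fix x assume x: "x \<in> pverts D - K"
    \<comment> \<open>A vertex without out-arcs reaches only itself, so it is terminal, its own
      representative, and hence in \<open>K\<close>.\<close>
    have "\<exists>y. (x, y) \<in> ?A"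
    proof (rule ccontr)
      assume "\<not> ?thesis"
      then have only: "y = x" if "(x, y) \<in> ?A\<^sup>*" for y
        using that by (metis converse_rtranclE)
      then have "terminal ?A x" "representative ?A x = x"
        using reachable_representative[of x ?A] by (auto simp: terminal_def dest: only)
      with x show False by (simp add: K_def)
    qed
    moreover have "\<Union>\<F> = ?A"
      using assms(2) by (simp add: H_class_partition_def partition_on_def)
    ultimately obtain y where "(x, y) \<in> \<Union>\<F>"
      by blast
    then obtain F where F: "F \<in> \<F>" "(x, y) \<in> F" by blast
    then have xF: "x \<in> pverts (arc_induced F)"
      by (force simp: arc_induced_def)
    have "\<exists>P. vwalk P (with_proj (H_class_digraph \<F>)) \<and> hd P = F \<and> last P \<in> S
            \<and> vwalk_length P \<le> l"
    proof (cases "F \<in> S")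
      case True
      then show ?thesis
        using F by (intro exI[of _ "[F]"]) (auto simp: vwalk_def H_class_digraph_def)
    next
      case False
      then show ?thesis
        using F assms(6) by (auto simp: kl_kernel_def H_class_digraph_def)
    qed
    then obtain P where P: "vwalk P (with_proj (H_class_digraph \<F>))" "hd P = F" "last P \<in> S"
        "vwalk_length P \<le> l"
      by blast
    have "\<exists>p. vwalk p (with_proj D) \<and> hd p = x \<and> last p \<in> K
        \<and> entry_cost H \<rho> (hd P) p \<le> vwalk_length P"
      by (rule class_walk_lift[OF assms(2) wf assms(3) _ P(1,3)])
        (use absorb xF P(2) in simp_all)
    then obtain p where "vwalk p (with_proj D)" "hd p = x" "last p \<in> K"
        "entry_cost H \<rho> (hd P) p \<le> vwalk_length P"
      by blast
    \<comment> \<open>Entry cost bounds the number of obstructions by \<open>l\<close>; the extra 1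
      is the one in the definition of \<open>H_length\<close>.\<close>
    then show "\<exists>p. vwalk p (with_proj D) \<and> hd p = x \<and> last p \<in> K \<and> H_length H \<rho> p \<le> l + 1"
      using P(4) by (intro exI[of _ p]) (auto simp: entry_cost_def H_length_def)
  qed
  then show ?thesis by blast
qed

end
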